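(* Let $P$ be a finite poset and $\mathbb{K}$ a field. Let $R=\mathbb{K}[\{x_f: f\in\mathcal{F}^{(e)}(P)\}]$ and let $I_{\mathcal{O}^{(e)}(P)}$ be the ideal of $R$ generated by all squarefree monomials $x_fx_g$ satisfying either of the following conditions: (i) there exists $v\in\min(\operatorname{supp}(f))\cap\min(\operatorname{supp}(g))$ such that $f(v)\neq g(v)$; (ii) $\operatorname{supp}(f)\not\subseteq\operatorname{supp}(g)$, $\operatorname{supp}(f)\not\supseteq\operatorname{supp}(g)$, and $f(v)=g(v)$ for each $v\in\min(\operatorname{supp}(f))\cap\min(\operatorname{supp}(g))$. Then $\Delta(I_{\mathcal{O}^{(e)}(P)})=\mathcal{S}^{(e)}_P$, where $\mathcal{S}^{(e)}_P=\{\operatorname{conv}K: K\text{ is a chain in }\mathcal{F}^{(e)}(P)\}$ and a face $\sigma\subset\mathcal{F}^{(e)}(P)$ of $\Delta(I_{\mathcal{O}^{(e)}(P)})$ is identified with the simplex $\operatorname{conv}\sigma$.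
   Context: For $f:P\to\mathbb{R}$, $\operatorname{supp}(f)=\{v\in P: f(v)\neq 0\}$; $\min Q$ is the set of minimal elements of $Q\subset P$. An order filter of $P$ is a subset $F\subset P$ such that $v\in F$ and $v<w$ imply $w\in F$. $\mathcal{F}^{(e)}(P)$ is the set of $f:P\to\{1,0,-1\}$ such that $\operatorname{supp}(f)$ is an order filter of $P$, and if $f(v)=-1$ then $v$ is minimal in $\operatorname{supp}(f)$. It is partially ordered: $f>g$ if (i) $\operatorname{supp}(f)\supsetneq\operatorname{supp}(g)$; (ii) $f(v)\ge g(v)$ for any $v\in\operatorname{supp}(g)$; (iii) if $v\in\operatorname{supp}(g)$ and $v$ is minimal in $\operatorname{supp}(f)$, then $f(v)=g(v)$. Chains in $\mathcal{F}^{(e)}(P)$ include the empty chain. For a simplicial complex $\Delta$ on a finite index set of variables, its Stanley–Reisner ideal $I_\Delta$ is generated by the squarefree monomials $\prod_{i\in F}x_i$ with $F\notin\Delta$. For a squarefree monomial ideal $I$, $\Delta(I)$ is the unique simplicial complex with $I=I_{\Delta(I)}$; here its vertices are elements of $\mathcal{F}^{(e)}(P)$. *)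

theory Defs
  imports "HOL-Analysis.Analysis" "HOL-Analysis.Finite_Function_Topology" "HOL-Algebra.Algebraic_Closure_Type"
begin

section \<open>Stanley--Reisner ideals\<close>

text \<open>
  A polynomial maps each monomial (an exponent vector, of type \<open>'v \<Rightarrow>\<^sub>0 nat\<close>) to its coefficient.
  The variables of \<open>\<K>[x\<^sub>i : i \<in> V]\<close> are indexed by a set \<open>V\<close>, so that ring is a
  subring of the polynomial ring in all variables of the index type.
\<close>

type_synonym ('v, 'k) mpoly = "('v \<Rightarrow>\<^sub>0 nat) \<Rightarrow>\<^sub>0 'k"

definition var :: "'v \<Rightarrow> ('v, 'k::field) mpoly"
  where "var i = Poly_Mapping.single (Poly_Mapping.single i 1) 1"

definition poly_ring :: "'v set \<Rightarrow> ('v, 'k::field) mpoly ring"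
  where "poly_ring V = ring_of_type_algebra
    \<lparr>carrier := {p. \<forall>m \<in> Poly_Mapping.keys p. Poly_Mapping.keys m \<subseteq> V}\<rparr>"

text \<open>
  Neither \<open>{} \<in> \<Delta>\<close> nor \<open>{i} \<in> \<Delta>\<close> for \<open>i \<in> V\<close> is required: the void complex corresponds to the unit
  ideal, and a missing vertex \<open>i\<close> to \<open>x\<^sub>i\<close> lying in the ideal.  With this convention
  \<open>\<Delta> \<mapsto> I\<^sub>\<Delta>\<close> is a bijection onto all squarefree monomial ideals.
\<close>

definition simplicial_complex :: "'v set \<Rightarrow> 'v set set \<Rightarrow> bool"
  where "simplicial_complex V \<Delta> \<longleftrightarrow> \<Delta> \<subseteq> Pow V \<and> (\<forall>\<sigma> \<in> \<Delta>. \<forall>\<tau>. \<tau> \<subseteq> \<sigma> \<longrightarrow> \<tau> \<in> \<Delta>)"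

definition SR_ideal :: "'v set \<Rightarrow> 'v set set \<Rightarrow> ('v, 'k::field) mpoly set"
  where "SR_ideal V \<Delta> = Idl\<^bsub>poly_ring V\<^esub> {\<Prod>i\<in>F. var i | F. F \<subseteq> V \<and> F \<notin> \<Delta>}"

definition SR_complex :: "'v set \<Rightarrow> ('v, 'k::field) mpoly set \<Rightarrow> 'v set set"
  where "SR_complex V I = (THE \<Delta>. simplicial_complex V \<Delta> \<and> I = SR_ideal V \<Delta>)"


section \<open>Enriched order filters\<close>

text \<open>
  A finite poset is a finite subset \<open>P\<close> of a partially ordered type, with the induced order.
  A function \<open>f : P \<rightarrow> \<real>\<close> is encoded as a finitely supported function \<open>'p \<Rightarrow>\<^sub>0 real\<close> vanishing outside
  \<open>P\<close>; thus \<open>supp(f)\<close> is \<^const>\<open>Poly_Mapping.keys\<close>, \<open>f(v)\<close> is \<^const>\<open>Poly_Mapping.lookup\<close>, and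
  convex hulls in \<open>\<real>\<^sup>P\<close> are those of the real vector space \<open>'p \<Rightarrow>\<^sub>0 real\<close>.
\<close>

abbreviation supp :: "('p \<Rightarrow>\<^sub>0 real) \<Rightarrow> 'p set"
  where "supp \<equiv> Poly_Mapping.keys"

abbreviation val :: "('p \<Rightarrow>\<^sub>0 real) \<Rightarrow> 'p \<Rightarrow> real"
  where "val \<equiv> Poly_Mapping.lookup"

definition min_elems :: "'p::order set \<Rightarrow> 'p set"
  where "min_elems Q = {v \<in> Q. \<not> (\<exists>w \<in> Q. w < v)}"

definition order_filter :: "'p::order set \<Rightarrow> 'p set \<Rightarrow> bool"
  where "order_filter P F \<longleftrightarrow> F \<subseteq> P \<and> (\<forall>v \<in> F. \<forall>w \<in> P. v < w \<longrightarrow> w \<in> F)"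

definition enriched_filters :: "'p::order set \<Rightarrow> ('p \<Rightarrow>\<^sub>0 real) set"
  where "enriched_filters P = {f. order_filter P (supp f)
    \<and> (\<forall>v \<in> P. val f v \<in> {1, 0, -1})
    \<and> (\<forall>v \<in> P. val f v = -1 \<longrightarrow> v \<in> min_elems (supp f))}"

definition enriched_less :: "('p::order \<Rightarrow>\<^sub>0 real) \<Rightarrow> ('p \<Rightarrow>\<^sub>0 real) \<Rightarrow> bool"
  where "enriched_less g f \<longleftrightarrow> supp g \<subset> supp f
    \<and> (\<forall>v \<in> supp g. val f v \<ge> val g v)
    \<and> (\<forall>v \<in> supp g. v \<in> min_elems (supp f) \<longrightarrow> val f v = val g v)"

definition enriched_simplices :: "'p::order set \<Rightarrow> ('p \<Rightarrow>\<^sub>0 real) set set"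
  where "enriched_simplices P =
    {convex hull K | K. pred_on.chain (enriched_filters P) enriched_less K}"

text \<open>Each of the two conditions forces \<open>f \<noteq> g\<close>, so the generators are squarefree.\<close>

definition enriched_ideal :: "'p::order set \<Rightarrow> ('p \<Rightarrow>\<^sub>0 real, 'k::field) mpoly set"
  where "enriched_ideal P = Idl\<^bsub>poly_ring (enriched_filters P)\<^esub>
    {var f * var g | f g. f \<in> enriched_filters P \<and> g \<in> enriched_filters P \<and>
       ((\<exists>v \<in> min_elems (supp f) \<inter> min_elems (supp g). val f v \<noteq> val g v) \<or>
        (\<not> supp f \<subseteq> supp g \<and> \<not> supp f \<supseteq> supp g \<and>
         (\<forall>v \<in> min_elems (supp f) \<inter> min_elems (supp g). val f v = val g v)))}"

end

theory Submission
  imports Defs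
begin

text \<open>
  On the support of an enriched filter, every value off the minimal elements is \<open>1\<close>.  Hence if the
  values of \<open>f\<close> and \<open>g\<close> agree on the common minimal elements and their supports are nested, then
  \<open>f\<close> and \<open>g\<close> are comparable or equal: the generators of the ideal are exactly the incomparable
  pairs.  The faces of the complex are therefore the chains.  Supports grow strictly along
  a chain, so its elements are affinely independent, and a simplex determines its vertices as its
  extreme points.
\<close>

section \<open>Monomials and the polynomial ring on a set of variables\<close>

lemma keys_add_nat:
  fixes a b :: "'v \<Rightarrow>\<^sub>0 nat"
  shows "Poly_Mapping.keys (a + b) = Poly_Mapping.keys a \<union> Poly_Mapping.keys b"
  by (auto simp: in_keys_iff lookup_add)

lemma prod_var:
  "(\<Prod>i\<in>F. var i :: ('v, 'k::field) mpoly)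
     = Poly_Mapping.single (\<Sum>i\<in>F. Poly_Mapping.single i 1) 1"
  by (induction F rule: infinite_finite_induct) (auto simp: var_def mult_single)

lemma keys_sum_single:
  "finite F \<Longrightarrow> Poly_Mapping.keys (\<Sum>i\<in>F. Poly_Mapping.single i (1::nat)) = F"
  by (induction F rule: finite_induct) (auto simp: keys_add_nat)

lemma carrier_poly_ring:
  "carrier (poly_ring V) = {p. \<forall>m \<in> Poly_Mapping.keys p. Poly_Mapping.keys m \<subseteq> V}"
  by (simp add: poly_ring_def)

lemma poly_ring_simps [simp]:
  "mult (poly_ring V) p q = p * q"
  "one (poly_ring V) = 1"
  "zero (poly_ring V) = 0"
  "add (poly_ring V) p q = p + q"
  by (simp_all add: poly_ring_def ring_of_type_algebra_def)

lemma poly_ring_closed: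
  fixes p q :: "('v, 'k::field) mpoly"
  shows "0 \<in> carrier (poly_ring V :: ('v, 'k) mpoly ring)"
    and "1 \<in> carrier (poly_ring V :: ('v, 'k) mpoly ring)"
    and "p \<in> carrier (poly_ring V) \<Longrightarrow> - p \<in> carrier (poly_ring V)"
    and "p \<in> carrier (poly_ring V) \<Longrightarrow> q \<in> carrier (poly_ring V) \<Longrightarrow> p + q \<in> carrier (poly_ring V)"
    and "p \<in> carrier (poly_ring V) \<Longrightarrow> q \<in> carrier (poly_ring V) \<Longrightarrow> p * q \<in> carrier (poly_ring V)"
proof -
  assume p: "p \<in> carrier (poly_ring V)" and q: "q \<in> carrier (poly_ring V)"
  show "p + q \<in> carrier (poly_ring V)"
    using p q keys_add[of p q] unfolding carrier_poly_ring by blast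
  show "p * q \<in> carrier (poly_ring V)"
    unfolding carrier_poly_ring mem_Collect_eq
  proof
    fix m assume "m \<in> Poly_Mapping.keys (p * q)"
    then obtain a b where "a \<in> Poly_Mapping.keys p" "b \<in> Poly_Mapping.keys q" "m = a + b"
      using keys_mult[of p q] by blast
    then show "Poly_Mapping.keys m \<subseteq> V"
      using p q by (auto simp: carrier_poly_ring keys_add_nat)
  qed
qed (simp_all add: carrier_poly_ring)

lemma ring_poly_ring: "ring (poly_ring V :: ('v, 'k::field) mpoly ring)"
proof (rule ringI)
  show "abelian_group (poly_ring V :: ('v, 'k) mpoly ring)"
  proof (rule abelian_groupI)
    fix p :: "('v, 'k) mpoly" assume "p \<in> carrier (poly_ring V)"
    then show "\<exists>q\<in>carrier (poly_ring V). q \<oplus>\<^bsub>poly_ring V\<^esub> p = \<zero>\<^bsub>poly_ring V\<^esub>"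
      by (intro bexI[of _ "- p"]) (simp_all add: poly_ring_closed)
  qed (simp_all add: poly_ring_closed algebra_simps)
  show "monoid (poly_ring V :: ('v, 'k) mpoly ring)"
    by (rule monoidI) (simp_all add: poly_ring_closed algebra_simps)
qed (simp_all add: algebra_simps)

lemma prod_var_carrier:
  assumes "F \<subseteq> V"
  shows "(\<Prod>i\<in>F. var i :: ('v, 'k::field) mpoly) \<in> carrier (poly_ring V)"
proof (cases "finite F")
  case True
  then show ?thesis using assms
    by (simp add: carrier_poly_ring prod_var keys_sum_single del: One_nat_def)
qed (simp add: poly_ring_closed)

section \<open>The Stanley-Reisner correspondence and flag complexes\<close>

text \<open>Multiplication only enlarges the support of a monomial, since natural exponents cannot
  cancel, and a superset of a nonface is never a face. This ideal bounds \<open>SR_ideal\<close>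
  from above and makes membership readable from supports.\<close>

lemma ideal_nonface_polys:
  assumes "simplicial_complex V \<Delta>"
  shows "ideal {p \<in> carrier (poly_ring V :: ('v, 'k::field) mpoly ring).
                  \<forall>m \<in> Poly_Mapping.keys p. Poly_Mapping.keys m \<notin> \<Delta>} (poly_ring V)"
    (is "ideal ?J ?R")
proof -
  interpret R: ring ?R by (rule ring_poly_ring)
  have mult: "p * q \<in> ?J" if p: "p \<in> ?J" and q: "q \<in> carrier ?R" for p q
  proof -
    have "Poly_Mapping.keys m \<notin> \<Delta>" if m: "m \<in> Poly_Mapping.keys (p * q)" for m
    proof -
      from m keys_mult[of p q] obtain a b where "a \<in> Poly_Mapping.keys p" "m = a + b"
        by blast
      moreover from this p have "Poly_Mapping.keys a \<notin> \<Delta>" by blast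
      moreover have "Poly_Mapping.keys a \<subseteq> Poly_Mapping.keys (a + b)" by (simp add: keys_add_nat)
      ultimately show ?thesis using assms unfolding simplicial_complex_def by blast
    qed
    then show ?thesis using p q by (simp add: poly_ring_closed)
  qed
  show ?thesis
  proof (rule idealI[OF R.ring_axioms])
    show "subgroup ?J (add_monoid ?R)"
    proof (rule R.add.subgroupI)
      show "?J \<noteq> {}" using poly_ring_closed(1)[of V, where 'k='k] by (auto intro: exI[of _ 0])
    next
      fix p assume p: "p \<in> ?J"
      \<comment> \<open>The additive inverse of the ring record is defined abstractly, so it is
        first identified with the negation of the type.\<close>
      then have "\<ominus>\<^bsub>?R\<^esub> p = - p"
        by (intro R.minus_equality) (simp_all add: poly_ring_closed)
      with p show "\<ominus>\<^bsub>?R\<^esub> p \<in> ?J" by (simp add: poly_ring_closed)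
    next
      fix p q assume "p \<in> ?J" "q \<in> ?J"
      then show "p \<oplus>\<^bsub>?R\<^esub> q \<in> ?J"
        using keys_add[of p q] poly_ring_closed(4)[of p V q] unfolding poly_ring_simps by blast
    qed blast
  next
    fix p q assume "p \<in> ?J" "q \<in> carrier ?R"
    then show "q \<otimes>\<^bsub>?R\<^esub> p \<in> ?J" "p \<otimes>\<^bsub>?R\<^esub> q \<in> ?J"
      using mult[of p q] unfolding poly_ring_simps by (simp_all add: mult.commute)
  qed
qed

text \<open>The monomial of a nonface is a generator; that of a face is kept out by the larger ideal
  \<open>?J\<close>. Finiteness of \<open>V\<close> prevents the product from taking its default
  value 1 on an infinite \<open>F\<close>.\<close>

lemma prod_var_in_SR_ideal_iff:
  assumes "finite V" "simplicial_complex V \<Delta>" "F \<subseteq> V"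
  shows "(\<Prod>i\<in>F. var i) \<in> (SR_ideal V \<Delta> :: ('v, 'k::field) mpoly set) \<longleftrightarrow> F \<notin> \<Delta>"
proof -
  interpret R: ring "poly_ring V :: ('v, 'k) mpoly ring" by (rule ring_poly_ring)
  let ?G = "{\<Prod>i\<in>F. var i | F. F \<subseteq> V \<and> F \<notin> \<Delta>} :: ('v, 'k) mpoly set"
  let ?J = "{p \<in> carrier (poly_ring V :: ('v, 'k) mpoly ring).
               \<forall>m \<in> Poly_Mapping.keys p. Poly_Mapping.keys m \<notin> \<Delta>}"
  have J: "(\<Prod>i\<in>F. var i) \<in> ?J \<longleftrightarrow> F \<notin> \<Delta>" if "F \<subseteq> V" for F
    using that prod_var_carrier[OF that] finite_subset[OF that \<open>finite V\<close>]
    by (auto simp: prod_var keys_sum_single simp del: One_nat_def)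
  have G: "?G \<subseteq> carrier (poly_ring V)"
    using prod_var_carrier by blast
  have "?G \<subseteq> ?J" using J by blast
  then have "SR_ideal V \<Delta> \<subseteq> ?J"
    unfolding SR_ideal_def by (intro R.genideal_minimal ideal_nonface_polys assms)
  moreover have "?G \<subseteq> SR_ideal V \<Delta>"
    unfolding SR_ideal_def by (rule R.genideal_self[OF G])
  ultimately show ?thesis using J[OF \<open>F \<subseteq> V\<close>] \<open>F \<subseteq> V\<close> by blast
qed

text \<open>The squarefree monomials in the ideal reveal which subsets of \<open>V\<close> are
  faces, which gives the uniqueness that \<open>THE\<close> demands.\<close>

lemma SR_complex_SR_ideal:
  assumes "finite V" "simplicial_complex V \<Delta>"
  shows "SR_complex V (SR_ideal V \<Delta> :: ('v, 'k::field) mpoly set) = \<Delta>"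
  unfolding SR_complex_def
proof (rule the_equality)
  fix \<Delta>' assume "simplicial_complex V \<Delta>' \<and> (SR_ideal V \<Delta> :: ('v, 'k) mpoly set) = SR_ideal V \<Delta>'"
  then have "F \<in> \<Delta>' \<longleftrightarrow> F \<in> \<Delta>" if "F \<subseteq> V" for F
    using prod_var_in_SR_ideal_iff[OF assms that, where 'k='k]
      prod_var_in_SR_ideal_iff[OF \<open>finite V\<close> _ that, where \<Delta>=\<Delta>' and 'k='k] by blast
  moreover have "\<Delta> \<subseteq> Pow V" "\<Delta>' \<subseteq> Pow V"
    using assms(2) \<open>simplicial_complex V \<Delta>' \<and> _\<close> by (auto simp: simplicial_complex_def)
  ultimately show "\<Delta>' = \<Delta>" by blast
qed (use assms in simp)

text \<open>The quadratic monomials form the edge ideal of the graph \<open>N\<close>, and the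
  complex consists of its independent sets. A nonface contains some edge, so its monomial is a
  multiple of a quadratic generator; conversely, every edge is a nonface. Irreflexivity of
  \<open>N\<close> makes the generators squarefree.\<close>

lemma SR_ideal_flag:
  assumes "finite V" and "\<And>i. i \<in> V \<Longrightarrow> \<not> N i i"
  shows "SR_ideal V {\<sigma>. \<sigma> \<subseteq> V \<and> (\<forall>i\<in>\<sigma>. \<forall>j\<in>\<sigma>. \<not> N i j)}
      = Idl\<^bsub>poly_ring V\<^esub> {var i * var j :: ('v, 'k::field) mpoly | i j. i \<in> V \<and> j \<in> V \<and> N i j}"
    (is "SR_ideal V ?\<Delta> = Idl\<^bsub>?R\<^esub> ?G")
proof
  interpret R: ring ?R by (rule ring_poly_ring)
  have pair: "var i * var j = (\<Prod>k\<in>{i, j}. var k :: ('v, 'k) mpoly)" if "i \<in> V" "N i j" for i j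
    using that assms(2) by (subst prod.insert) auto
  have G: "?G \<subseteq> carrier ?R"
  proof
    fix p assume "p \<in> ?G"
    then obtain i j where "i \<in> V" "j \<in> V" "N i j" "p = var i * var j" by blast
    then show "p \<in> carrier ?R" using prod_var_carrier[of "{i, j}" V] pair by simp
  qed
  interpret I: ideal "Idl\<^bsub>?R\<^esub> ?G" ?R by (rule R.genideal_ideal[OF G])
  show "SR_ideal V ?\<Delta> \<subseteq> Idl\<^bsub>?R\<^esub> ?G"
    unfolding SR_ideal_def
  proof (rule R.genideal_minimal[OF I.is_ideal], rule subsetI)
    fix p :: "('v, 'k) mpoly" assume "p \<in> {\<Prod>i\<in>F. var i | F. F \<subseteq> V \<and> F \<notin> ?\<Delta>}"
    then obtain F i j where F: "p = (\<Prod>i\<in>F. var i)" "F \<subseteq> V" "i \<in> F" "j \<in> F" "N i j"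
      by blast
    have "finite F" using F \<open>finite V\<close> finite_subset by blast
    then have "p = (\<Prod>k\<in>{i, j}. var k) * (\<Prod>k\<in>F - {i, j}. var k)"
      using F by (simp add: prod.subset_diff[of "{i, j}" F] mult.commute)
    also have "(\<Prod>k\<in>{i, j}. var k) = (var i * var j :: ('v, 'k) mpoly)"
      using pair F by auto
    finally have p: "p = var i * var j * (\<Prod>k\<in>F - {i, j}. var k)" .
    have "var i * var j \<in> Idl\<^bsub>?R\<^esub> ?G"
      using R.genideal_self[OF G] F by blast
    moreover have "(\<Prod>k\<in>F - {i, j}. var k :: ('v, 'k) mpoly) \<in> carrier ?R"
      using F by (intro prod_var_carrier) auto
    ultimately show "p \<in> Idl\<^bsub>?R\<^esub> ?G"
      using I.I_r_closed unfolding p poly_ring_simps by blast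
  qed
  have "simplicial_complex V ?\<Delta>" by (auto simp: simplicial_complex_def)
  show "Idl\<^bsub>?R\<^esub> ?G \<subseteq> SR_ideal V ?\<Delta>"
  proof (rule R.genideal_minimal)
    show "ideal (SR_ideal V ?\<Delta>) ?R"
      unfolding SR_ideal_def using prod_var_carrier by (intro R.genideal_ideal) blast
    show "?G \<subseteq> SR_ideal V ?\<Delta>"
    proof
      fix p assume "p \<in> ?G"
      then obtain i j where ij: "i \<in> V" "j \<in> V" "N i j" "p = var i * var j" by blast
      then have "(\<Prod>k\<in>{i, j}. var k) \<in> (SR_ideal V ?\<Delta> :: ('v, 'k) mpoly set)"
        by (subst prod_var_in_SR_ideal_iff[OF \<open>finite V\<close> \<open>simplicial_complex V ?\<Delta>\<close>]) auto
      then show "p \<in> SR_ideal V ?\<Delta>" using pair ij by simp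
    qed
  qed
qed

section \<open>Conflicts and comparability of enriched filters\<close>

lemma min_elems_mono: "A \<subseteq> B \<Longrightarrow> v \<in> A \<Longrightarrow> v \<in> min_elems B \<Longrightarrow> v \<in> min_elems A"
  by (auto simp: min_elems_def)

lemma enriched_filters_val:
  assumes "f \<in> enriched_filters P" "v \<in> supp f"
  shows "v \<in> min_elems (supp f) \<and> val f v \<in> {1, -1} \<or> val f v = 1"
proof -
  have "v \<in> P" "val f v \<noteq> 0"
    using assms by (auto simp: enriched_filters_def order_filter_def in_keys_iff)
  then show ?thesis using assms by (auto simp: enriched_filters_def)
qed

lemma finite_enriched_filters:
  assumes "finite P"
  shows "finite (enriched_filters P)"
proof (rule finite_imageD)
  show "inj_on val (enriched_filters P)"
    by (simp add: inj_on_def lookup_inject)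
  have "val ` enriched_filters P \<subseteq> {h. \<forall>v. (v \<in> P \<longrightarrow> h v \<in> {1, 0, -1}) \<and> (v \<notin> P \<longrightarrow> h v = 0)}"
    by (auto simp: enriched_filters_def order_filter_def in_keys_iff)
  then show "finite (val ` enriched_filters P)"
    using finite_set_of_finite_funs[OF assms, of "{1, 0, -1}" 0] finite_subset by auto
qed

text \<open>This is the condition on the generators of \<open>enriched_ideal\<close>, named so that
  it can serve as the relation \<open>N\<close> of \<open>SR_ideal_flag\<close>.\<close>

definition enriched_conflict :: "('p::order \<Rightarrow>\<^sub>0 real) \<Rightarrow> ('p \<Rightarrow>\<^sub>0 real) \<Rightarrow> bool" where
  "enriched_conflict f g \<longleftrightarrow>
     (\<exists>v \<in> min_elems (supp f) \<inter> min_elems (supp g). val f v \<noteq> val g v) \<or>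
     (\<not> supp f \<subseteq> supp g \<and> \<not> supp f \<supseteq> supp g \<and>
      (\<forall>v \<in> min_elems (supp f) \<inter> min_elems (supp g). val f v = val g v))"

lemma enriched_conflict_sym: "enriched_conflict f g \<longleftrightarrow> enriched_conflict g f"
  unfolding enriched_conflict_def by (auto simp: Int_commute)

text \<open>Nested supports exclude the second alternative of a conflict. A common minimal element
  lies in the smaller support and is minimal in the larger one, so clause (iii) of the order
  excludes the first.\<close>

lemma enriched_less_not_conflict:
  assumes "enriched_less f g"
  shows "\<not> enriched_conflict f g"
  using assms by (auto simp: enriched_less_def enriched_conflict_def min_elems_def)

text \<open>Absence of conflict makes the supports nested, say that of \<open>f\<close> inside that
  of \<open>g\<close>. A point of \<open>supp f\<close> that is minimal in \<open>supp g\<close> is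
  also minimal in \<open>supp f\<close>, so the values agree there; elsewhere on
  \<open>supp f\<close> the value of \<open>g\<close> is 1, the largest possible.\<close>

lemma not_conflict_imp_comparable:
  assumes "f \<in> enriched_filters P" "g \<in> enriched_filters P" "\<not> enriched_conflict f g"
  shows "enriched_less f g \<or> f = g \<or> enriched_less g f"
proof -
  have le: "enriched_less f g \<or> f = g"
    if f: "f \<in> enriched_filters P" and g: "g \<in> enriched_filters P"
      and nc: "\<not> enriched_conflict f g" and sub: "supp f \<subseteq> supp g" for f g
  proof -
    have eq: "val f v = val g v" if "v \<in> supp f" "v \<in> min_elems (supp g)" for v
      using nc min_elems_mono[OF sub that] that by (auto simp: enriched_conflict_def)
    have one: "val g v = 1" if "v \<in> supp f" "v \<notin> min_elems (supp g)" for v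
      using enriched_filters_val[OF g] sub that by blast
    show ?thesis
    proof (cases "supp f = supp g")
      case True
      have "val f v = val g v" for v
      proof (cases "v \<in> supp f")
        case v: True
        show ?thesis
          \<comment> \<open>With equal supports, a point that is not minimal for \<open>g\<close> is
            not minimal for \<open>f\<close> either, so both values are 1.\<close>
          using eq[OF v] one[OF v] enriched_filters_val[OF f v] True by metis
      next
        case False
        then show ?thesis using True by (metis in_keys_iff)
      qed
      then show ?thesis by (simp add: poly_mapping_eqI)
    next
      case False
      have "val f v \<le> val g v" if "v \<in> supp f" for v
        using eq[OF that] one[OF that] enriched_filters_val[OF f that] by fastforce
      then show ?thesis using False sub eq by (auto simp: enriched_less_def)
    qed
  qed
  have "supp f \<subseteq> supp g \<or> supp g \<subseteq> supp f"
    using assms(3) by (auto simp: enriched_conflict_def)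
  then show ?thesis
    using le[OF assms] le[OF assms(2,1)] assms(3) enriched_conflict_sym by blast
qed

text \<open>\<open>pred_on.chain\<close> compares by the reflexive closure, which fits here because
  no filter conflicts with itself.\<close>

lemma chain_iff_no_conflict:
  "pred_on.chain (enriched_filters P) enriched_less K \<longleftrightarrow>
     K \<subseteq> enriched_filters P \<and> (\<forall>f\<in>K. \<forall>g\<in>K. \<not> enriched_conflict f g)"
proof -
  have "\<not> enriched_conflict f f" for f :: "'a \<Rightarrow>\<^sub>0 real"
    by (auto simp: enriched_conflict_def)
  then show ?thesis
    unfolding pred_on.chain_def
    using enriched_less_not_conflict enriched_conflict_sym not_conflict_imp_comparable
    by (smt (verit, best) subsetD sup2CI sup2E)
qed

lemma SR_complex_enriched_ideal:
  fixes P :: "'p::order set"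
  assumes "finite P"
  shows "SR_complex (enriched_filters P) (enriched_ideal P :: ('p \<Rightarrow>\<^sub>0 real, 'k::field) mpoly set)
      = {K. pred_on.chain (enriched_filters P) enriched_less K}"
proof -
  let ?V = "enriched_filters P"
  let ?\<Delta> = "{\<sigma>. \<sigma> \<subseteq> ?V \<and> (\<forall>f\<in>\<sigma>. \<forall>g\<in>\<sigma>. \<not> enriched_conflict f g)}"
  have fin: "finite ?V" by (rule finite_enriched_filters[OF assms])
  have "(enriched_ideal P :: ('p \<Rightarrow>\<^sub>0 real, 'k) mpoly set) = SR_ideal ?V ?\<Delta>"
    unfolding enriched_ideal_def enriched_conflict_def[symmetric]
    by (rule SR_ideal_flag[symmetric, OF fin]) (auto simp: enriched_conflict_def)
  moreover have "simplicial_complex ?V ?\<Delta>" by (auto simp: simplicial_complex_def)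
  ultimately show ?thesis
    by (simp add: SR_complex_SR_ideal[OF fin] chain_iff_no_conflict)
qed

section \<open>Affine independence of chains and the simplices they span\<close>

lemma lookup_scaleR: "Poly_Mapping.lookup (c *\<^sub>R x) i = c *\<^sub>R Poly_Mapping.lookup x i"
proof -
  have "finite {i. c *\<^sub>R Poly_Mapping.lookup x i \<noteq> 0}"
    by (rule finite_subset[OF _ finite_lookup[of x]]) auto
  then show ?thesis by (simp add: scaleR_poly_mapping_def)
qed

text \<open>A triangularity argument: in an affine relation, evaluation at a point lying only in the
  largest support involved isolates one coefficient and forces it to vanish.\<close>

lemma affine_independent_supp_chain:
  fixes K :: "('p \<Rightarrow>\<^sub>0 real) set"
  assumes chain: "\<And>f g. f \<in> K \<Longrightarrow> g \<in> K \<Longrightarrow> f \<noteq> g \<Longrightarrow> supp f \<subset> supp g \<or> supp g \<subset> supp f"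
  shows "\<not> affine_dependent K"
proof
  assume "affine_dependent K"
  then obtain S u where S: "finite S" "S \<subseteq> K" "sum u S = 0" "\<exists>v\<in>S. u v \<noteq> 0"
      "(\<Sum>v\<in>S. u v *\<^sub>R v) = 0"
    unfolding affine_dependent_explicit by blast
  \<comment> \<open>Dropping the zero coefficients preserves both sums and makes every remaining
    coefficient usable for a contradiction.\<close>
  define T where "T = {v\<in>S. u v \<noteq> 0}"
  have T: "finite T" "T \<subseteq> K" "T \<noteq> {}" using S by (auto simp: T_def)
  have "sum u T = sum u S"
    using S(1) by (intro sum.mono_neutral_left) (auto simp: T_def)
  moreover have "(\<Sum>v\<in>T. u v *\<^sub>R v) = (\<Sum>v\<in>S. u v *\<^sub>R v)"
    using S(1) by (intro sum.mono_neutral_left) (auto simp: T_def)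
  ultimately have sumT: "sum u T = 0" "(\<Sum>v\<in>T. u v *\<^sub>R v) = 0"
    using S(3,5) by simp_all
  have max: "\<exists>f\<in>A. \<forall>g\<in>A. supp g \<subseteq> supp f" if A: "A \<subseteq> T" "A \<noteq> {}" for A
  proof -
    have "finite (supp ` A)" using A(1) T(1) finite_subset by blast
    then obtain f where f: "f \<in> A" "\<forall>g\<in>A. supp f \<subseteq> supp g \<longrightarrow> supp f = supp g"
      using finite_has_maximal[of "supp ` A"] A(2) by blast
    \<comment> \<open>Supports in \<open>K\<close> are totally ordered by inclusion, so a maximal
      one is the largest.\<close>
    have "supp g \<subseteq> supp f" if "g \<in> A" for g
      using chain[of f g] f that A T by (cases "f = g") blast+
    with f show ?thesis by blast
  qed
  obtain f where f: "f \<in> T" "\<forall>g\<in>T. supp g \<subseteq> supp f" using max[of T] T by blast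
  have "u f \<noteq> 0" using f by (simp add: T_def)
  show False
  proof (cases "T = {f}")
    \<comment> \<open>Here the vanishing of the coefficient sum is essential: \<open>f\<close> may
      be the zero function, for which the vector equation says nothing.\<close>
    case True
    then show False using sumT \<open>u f \<noteq> 0\<close> by simp
  next
    case False
    then obtain g where g: "g \<in> T - {f}" "\<forall>h\<in>T - {f}. supp h \<subseteq> supp g"
      using max[of "T - {f}"] f by blast
    then have "supp g \<subset> supp f" using chain[of g f] f T by blast
    \<comment> \<open>Of the elements of \<open>T\<close>, only \<open>f\<close> is nonzero at such a \<open>p\<close>.\<close>
    then obtain p where p: "p \<in> supp f" "p \<notin> supp g" by blast
    have "0 = (\<Sum>v\<in>T. u v * val v p)"
      using arg_cong[OF sumT(2), of "\<lambda>x. val x p"] by (simp add: lookup_sum lookup_scaleR)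
    also have "\<dots> = u f * val f p + (\<Sum>v\<in>T - {f}. u v * val v p)"
      using T f by (simp add: sum.remove)
    also have "(\<Sum>v\<in>T - {f}. u v * val v p) = 0"
    proof (intro sum.neutral ballI)
      fix h assume "h \<in> T - {f}"
      then have "p \<notin> supp h" using g p by blast
      then show "u h * val h p = 0" by (simp add: in_keys_iff)
    qed
    finally show False using \<open>u f \<noteq> 0\<close> p by (simp add: in_keys_iff)
  qed
qed

text \<open>Taking extreme points inverts the hull: a vertex lies outside the affine hull of the
  others, hence outside their convex hull, and adjoining such a point makes it extreme.\<close>

lemma inj_on_convex_hull_affine_independent:
  "inj_on (\<lambda>\<sigma>. convex hull \<sigma>) {S :: 'a::real_normed_vector set. finite S \<and> \<not> affine_dependent S}"
proof -
  have "{x. x extreme_point_of (convex hull S)} = S"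
    if "finite S" "\<not> affine_dependent S" for S :: "'a set"
  proof (rule antisym[OF extreme_points_of_convex_hull], rule subsetI, rule CollectI)
    fix x assume "x \<in> S"
    then have "x \<notin> convex hull (S - {x})"
      using that(2) convex_hull_subset_affine_hull[of "S - {x}"]
      unfolding affine_dependent_def by blast
    then have "x extreme_point_of (convex hull (insert x (S - {x})))"
      using that(1) by (intro extreme_point_of_convex_hull_insert) auto
    then show "x extreme_point_of (convex hull S)"
      using \<open>x \<in> S\<close> by (simp add: insert_absorb)
  qed
  then show ?thesis
    by (intro inj_on_inverseI[where g = "\<lambda>H. {x. x extreme_point_of H}"]) blast
qed

text \<open>The identification of a face with its hull is expressed as a bijection, and affine
  independence of each face ensures that the hull is a genuine simplex with the face as its vertex
  set.\<close>

theorem proposition4p2: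
  fixes P :: "'p::order set"
  assumes "finite P"
  shows "let \<Delta> = SR_complex (enriched_filters P)
                  (enriched_ideal P :: ('p \<Rightarrow>\<^sub>0 real, 'k::field) mpoly set)
    in (\<forall>\<sigma> \<in> \<Delta>. \<not> affine_dependent \<sigma>) \<and>
       bij_betw (\<lambda>\<sigma>. convex hull \<sigma>) \<Delta> (enriched_simplices P)"
proof -
  let ?\<Delta> = "{K. pred_on.chain (enriched_filters P) enriched_less K}"
  have indep: "\<not> affine_dependent K" if "K \<in> ?\<Delta>" for K
  proof (rule affine_independent_supp_chain)
    fix f g assume "f \<in> K" "g \<in> K" "f \<noteq> g"
    then have "enriched_less f g \<or> enriched_less g f"
      using that unfolding pred_on.chain_def by blast
    then show "supp f \<subset> supp g \<or> supp g \<subset> supp f"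
      unfolding enriched_less_def by blast
  qed
  moreover have "finite K" if "K \<in> ?\<Delta>" for K
    using that finite_subset[OF _ finite_enriched_filters[OF assms]]
    by (simp add: pred_on.chain_def)
  ultimately have "inj_on (\<lambda>\<sigma>. convex hull \<sigma>) ?\<Delta>"
    by (intro inj_on_subset[OF inj_on_convex_hull_affine_independent]) auto
  then have "bij_betw (\<lambda>\<sigma>. convex hull \<sigma>) ?\<Delta> (enriched_simplices P)"
    by (auto simp: bij_betw_def enriched_simplices_def)
  with indep show ?thesis
    by (simp add: SR_complex_enriched_ideal[OF assms])
qed

end
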